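(* Let $\mathcal{M}=(G, In, Out, Leak)$ be a linear compartmental model that is strongly connected and generically locally identifiable, has an input and an output in compartment $1$ and no other inputs or outputs ($In=Out=\{1\}$), and has singular-locus equation $f$ (in the sense defined in the context). Let $\widetilde{\mathcal{M}}$ be the model obtained from $\mathcal{M}$ by deleting a set of edges $\mathcal{I}$ of $G$ (keeping the same vertices and the same sets $In$, $Out$, $Leak$). If $\widetilde{\mathcal{M}}$ is strongly connected, and $f$ is not in the ideal $\langle a_{ji} \mid (i,j)\in\mathcal{I}\rangle$ (equivalently, the polynomial obtained from $f$ by setting $a_{ji}=0$ for all $(i,j)\in\mathcal{I}$ is nonzero), then $\widetilde{\mathcal{M}}$ is generically locally identifiable.
   Context: A linear compartmental model $\mathcal{M}=(G,In,Out,Leak)$ consists of a finite directed graph $G=(V,E)$ (no self-loops, no repeated edges) with $V=\{1,\dots,n\}$ (compartments) and three subsets $In,Out,Leak\subseteq V$ (input, output, leak compartments). Each edge $(i,j)$, i.e. $i\to j$, carries a parameter $a_{ji}$, and each leak $i\in Leak$ carries a parameter $a_{0i}$; these $|E|+|Leak|$ parameters are independent real variables. The model is strongly connected if $G$ is, i.e. there is a directed path from each vertex to every other vertex. The compartmental matrix is the $n\times n$ matrix $A$ with $A_{ij}=a_{ij}$ if $i\ne j$ and $j\to i$ is an edge, $A_{ij}=0$ if $i\neq j$ and $j\to i$ is not an edge, and $A_{ii}=-\sum_{k:\,i\to k\in E}a_{ki}$, with an additional summand $-a_{0i}$ if $i\in Leak$. For $In=Out=\{1\}$, the input-output equation is $\det(\partial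 I-A)\,y_1=\det((\partial I-A)_{11})\,u_1$, where $\partial=d/dt$ and $(\cdot)_{11}$ means removing row 1 and column 1. Writing $\det(\lambda I-A)=\lambda^n+c_{n-1}\lambda^{n-1}+\dots+c_0$ and $\det((\lambda I-A)_{11})=\lambda^{n-1}+d_{n-2}\lambda^{n-2}+\dots+d_0$, the coefficient map is the polynomial map $c=(c_0,\dots,c_{n-1},d_0,\dots,d_{n-2}):\mathbb{R}^{|E|+|Leak|}\to\mathbb{R}^{k}$, $k=2n-1$ (the constant leading coefficients $1$ are omitted). The model is generically locally identifiable if, outside a set of measure zero, every point of $\mathbb{R}^{|E|+|Leak|}$ has an open neighborhood $U$ such that $c|_U$ is one-to-one. Equivalently (known), the Jacobian matrix $\mathrm{Jac}(c)$ has rank $|E|+|Leak|$ at a generic point. Equation of the singular locus (singular-locus equation) of a generically locally identifiable model (so $|E|+|Leak|\le k$): if $|E|+|Leak|=k$, it is $\det(\mathrm{Jac}(c))$ (defined up to sign). If $|E|+|Leak|<k$, suppose there is a choice of $|E|+|Leak|$ of the coefficients of $c$, with resulting restricted coefficient map $r:\mathbb{R}^{|E|+|Leak|}\to\mathbb{R}^{|E|+|Leak|}$, such that at every parameter point $\det(\mathrm{Jac}(r))=0$ if and only if $\mathrm{Jac}(c)$ has rank strictly less than $|E|+|Leak|$; then $\det(\mathrm{Jac}(r))$ is the equation of the singular locus. It is a polynomial in the parameters with rational coefficients; the ideal in the claim is taken in the polynomial ring over $\mathbb{Q}$ in all the parameters. *)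

theory Defs
  imports
    "Graph_Theory.Graph_Theory"
    "Jordan_Normal_Form.Char_Poly"
    "Jordan_Normal_Form.DL_Rank"
    "HOL-Algebra.Ideal"
    "HOL-Library.Poly_Mapping"
    "HOL-Analysis.Function_Topology"
    "HOL-Analysis.Finite_Product_Measure"
    "HOL-Analysis.Lebesgue_Measure"
begin

section \<open>Polynomials over the rationals in the indeterminates \<open>a\<^sub>j\<^sub>i\<close>\<close>

text \<open>The parameter \<open>a\<^sub>j\<^sub>i\<close> is named by the pair \<open>(j, i)\<close>. Edges, in contrast, are written
  \<open>(i, j)\<close> for \<open>i \<rightarrow> j\<close>, so the parameter of the edge \<open>(i, j)\<close> is \<open>(j, i)\<close>. Compartments are
  numbered from 1, and \<open>(0, i)\<close> names the leak parameter \<open>a\<^sub>0\<^sub>i\<close>.\<close>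

type_synonym param = "nat \<times> nat"

text \<open>A monomial is a finitely supported exponent function.\<close>

type_synonym ppoly = "(param \<Rightarrow>\<^sub>0 nat) \<Rightarrow>\<^sub>0 rat"

definition pvar :: "param \<Rightarrow> ppoly" where
  "pvar v = Poly_Mapping.single (Poly_Mapping.single v 1) 1"

definition peval :: "(param \<Rightarrow> real) \<Rightarrow> ppoly \<Rightarrow> real" where
  "peval x p = (\<Sum>m\<in>Poly_Mapping.keys p.
     of_rat (Poly_Mapping.lookup p m) *
       (\<Prod>v\<in>Poly_Mapping.keys m. x v ^ Poly_Mapping.lookup m v))"

text \<open>The formal partial derivative with respect to \<open>v\<close>. A monomial not involving \<open>v\<close> contributes
  0 because of its coefficient, so the truncated subtraction in the exponent is harmless.\<close>

definition pdiff :: "param \<Rightarrow> ppoly \<Rightarrow> ppoly" where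
  "pdiff v p = (\<Sum>m\<in>Poly_Mapping.keys p.
     Poly_Mapping.single (m - Poly_Mapping.single v 1)
       (of_nat (Poly_Mapping.lookup m v) * Poly_Mapping.lookup p m))"

text \<open>\<open>param_ring P\<close> is the polynomial ring over the rationals in the indeterminates from \<open>P\<close>.\<close>

definition param_ring :: "param set \<Rightarrow> ppoly ring" where
  "param_ring P = \<lparr>carrier = {p. \<forall>m\<in>Poly_Mapping.keys p. Poly_Mapping.keys m \<subseteq> P},
     monoid.mult = (*), one = 1, zero = 0, add = (+)\<rparr>"

lemma cring_param_ring: "cring (param_ring P)"
proof (rule cringI)
  show "abelian_group (param_ring P)"
  proof (rule abelian_groupI)
    fix x assume "x \<in> carrier (param_ring P)"
    then have "- x \<in> carrier (param_ring P)" "- x \<oplus>\<^bsub>param_ring P\<^esub> x = \<zero>\<^bsub>param_ring P\<^esub>"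
      by (auto simp: param_ring_def)
    then show "\<exists>y\<in>carrier (param_ring P). y \<oplus>\<^bsub>param_ring P\<^esub> x = \<zero>\<^bsub>param_ring P\<^esub>" by blast
  qed (use Poly_Mapping.keys_add in \<open>fastforce simp: param_ring_def add_ac\<close>)+
  show "comm_monoid (param_ring P)"
  proof (rule comm_monoidI)
    fix x y assume xy: "x \<in> carrier (param_ring P)" "y \<in> carrier (param_ring P)"
    have "Poly_Mapping.keys m \<subseteq> P" if m: "m \<in> Poly_Mapping.keys (x * y)" for m
    proof -
      from m Poly_Mapping.keys_mult[of x y] obtain a b
        where "m = a + b" "a \<in> Poly_Mapping.keys x" "b \<in> Poly_Mapping.keys y" by blast
      then show ?thesis
        using xy Poly_Mapping.keys_add[of a b] by (fastforce simp: param_ring_def)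
    qed
    then show "x \<otimes>\<^bsub>param_ring P\<^esub> y \<in> carrier (param_ring P)" by (auto simp: param_ring_def)
  qed (auto simp: param_ring_def mult_ac)
qed (auto simp: param_ring_def algebra_simps)

section \<open>Linear compartmental models\<close>

record comp_model =
  graph :: "nat pair_pre_digraph"
  inputs :: "nat set"
  outputs :: "nat set"
  leaks :: "nat set"

definition linear_compartmental_model :: "comp_model \<Rightarrow> bool" where
  "linear_compartmental_model M \<longleftrightarrow> pair_digraph (graph M) \<and> (\<exists>n. pverts (graph M) = {1..n}) \<and>
     inputs M \<subseteq> pverts (graph M) \<and> outputs M \<subseteq> pverts (graph M) \<and> leaks M \<subseteq> pverts (graph M)"

definition ncomp :: "comp_model \<Rightarrow> nat" where
  "ncomp M = card (pverts (graph M))"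

definition params :: "comp_model \<Rightarrow> param set" where
  "params M = {(j, i) | i j. (i, j) \<in> parcs (graph M)} \<union> {(0, i) | i. i \<in> leaks M}"

definition delete_edges :: "comp_model \<Rightarrow> (nat \<times> nat) set \<Rightarrow> comp_model" where
  "delete_edges M I =
     M\<lparr>graph := (graph M)\<lparr>parcs := parcs (graph M) - I\<rparr>\<rparr>"

definition comp_entry :: "comp_model \<Rightarrow> (param \<Rightarrow> 'a::comm_ring_1) \<Rightarrow> nat \<Rightarrow> nat \<Rightarrow> 'a" where
  "comp_entry M a i j =
     (if i \<noteq> j then (if (j, i) \<in> parcs (graph M) then a (i, j) else 0)
      else - (\<Sum>k | (i, k) \<in> parcs (graph M). a (k, i)) - (if i \<in> leaks M then a (0, i) else 0))"

text \<open>The compartmental matrix. Compartment \<open>i\<close> has matrix index \<open>i - 1\<close>.\<close>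

definition comp_matrix :: "comp_model \<Rightarrow> (param \<Rightarrow> 'a::comm_ring_1) \<Rightarrow> 'a Matrix.mat" where
  "comp_matrix M a = Matrix.mat (ncomp M) (ncomp M) (\<lambda>(i, j). comp_entry M a (Suc i) (Suc j))"

text \<open>The coefficients \<open>(c\<^sub>0, \<dots>, c\<^sub>n\<^sub>-\<^sub>1, d\<^sub>0, \<dots>, d\<^sub>n\<^sub>-\<^sub>2)\<close> of the input-output equation, for
  \<open>In = Out = {1}\<close> only: the fields \<open>inputs\<close> and \<open>outputs\<close> do not enter. At a point of
  real parameter values this is the value of the coefficient map; at \<open>pvar\<close> it is the
  coefficient map as a tuple of polynomials.\<close>

definition coeff_map :: "comp_model \<Rightarrow> (param \<Rightarrow> 'a::comm_ring_1) \<Rightarrow> 'a Matrix.vec" where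
  "coeff_map M a = (let n = ncomp M; A = comp_matrix M a in
     Matrix.vec (2 * n - 1) (\<lambda>k. if k < n then Polynomial.coeff (char_poly A) k
       else Polynomial.coeff (Determinant.det (mat_delete (char_poly_matrix A) 0 0)) (k - n)))"

text \<open>Parameter space is \<open>params M \<rightarrow>\<^sub>E UNIV\<close> with its product topology and Lebesgue measure.\<close>

definition gen_loc_identifiable :: "comp_model \<Rightarrow> bool" where
  "gen_loc_identifiable M \<longleftrightarrow>
     (AE x in (\<Pi>\<^sub>M p\<in>params M. (lborel :: real measure)).
        \<exists>U. openin (product_topology (\<lambda>_. euclideanreal) (params M)) U \<and> x \<in> U \<and>
            inj_on (coeff_map M) U)"

section \<open>The equation of the singular locus\<close>

definition jacobian :: "param list \<Rightarrow> ppoly Matrix.vec \<Rightarrow> ppoly Matrix.mat" where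
  "jacobian xs c = Matrix.mat (dim_vec c) (length xs) (\<lambda>(i, j). pdiff (xs ! j) (vec_index c i))"

text \<open>The list \<open>xs\<close> orders the parameters, i.e. the columns of the Jacobian matrix, and the list
  \<open>rs\<close> selects the coefficients of the restricted map. Their order affects only the sign of
  the determinant.\<close>

definition singular_locus_eq :: "comp_model \<Rightarrow> ppoly \<Rightarrow> bool" where
  "singular_locus_eq M f \<longleftrightarrow> (\<exists>xs. distinct xs \<and> set xs = params M \<and>
     (let m = length xs; c = coeff_map M pvar; k = dim_vec c in
       m = k \<and> f \<in> {Determinant.det (jacobian xs c), - Determinant.det (jacobian xs c)} \<or>
       m < k \<and> (\<exists>rs. distinct rs \<and> set rs \<subseteq> {..<k} \<and> length rs = m \<and>
         (let r = Matrix.vec m (\<lambda>i. vec_index c (rs ! i)) in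
           (\<forall>x \<in> params M \<rightarrow>\<^sub>E UNIV.
              Determinant.det (map_mat (peval x) (jacobian xs r)) = 0 \<longleftrightarrow>
              vec_space.rank k (map_mat (peval x) (jacobian xs c)) < m) \<and>
           f \<in> {Determinant.det (jacobian xs r), - Determinant.det (jacobian xs r)}))))"

end

theory Submission
  imports Defs
begin

text \<open>
  The coefficient map of the submodel at \<open>x\<close> is the coefficient map \<open>c\<close> of \<open>M\<close> at the
  point \<open>ext x\<close> that extends \<open>x\<close> by 0 on the deleted edges. Since \<open>f\<close> is not in the ideal,
  it has a monomial free of the deleted parameters, so \<open>f (ext x) \<noteq> 0\<close> for almost all \<open>x\<close>, and \<open>f\<close>
  is up to sign the Jacobian determinant of some coefficients \<open>r\<close> of \<open>c\<close>. Hence \<open>c\<close> is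
  injective near \<open>ext x\<close>, and a fortiori on the subspace of points \<open>ext y\<close>.

  Local injectivity is obtained without the inverse function theorem: a polynomial
  satisfies \<open>p y - p z = (\<Sum>v. q\<^sub>v (y, z) * (y v - z v))\<close> with continuous \<open>q\<^sub>v\<close> that restrict to
  the partial derivatives on the diagonal. Thus \<open>r y - r z = Q (y, z) (y - z)\<close>
  with \<open>det (Q (x, x)) \<noteq> 0\<close>, and \<open>det (Q (y, z)) \<noteq> 0\<close> persists for \<open>y\<close>, \<open>z\<close> near \<open>x\<close>.
\<close>

section \<open>Evaluation as a ring homomorphism\<close>

definition mono_eval :: "(param \<Rightarrow> real) \<Rightarrow> (param \<Rightarrow>\<^sub>0 nat) \<Rightarrow> real" where
  "mono_eval x m = (\<Prod>v\<in>Poly_Mapping.keys m. x v ^ Poly_Mapping.lookup m v)"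

lemma mono_eval_superset:
  assumes "finite V" "Poly_Mapping.keys m \<subseteq> V"
  shows "mono_eval x m = (\<Prod>v\<in>V. x v ^ Poly_Mapping.lookup m v)"
  unfolding mono_eval_def using assms
  by (intro prod.mono_neutral_left) (auto simp: in_keys_iff)

lemma mono_eval_zero [simp]: "mono_eval x 0 = 1"
  by (simp add: mono_eval_def)

lemma mono_eval_single [simp]: "mono_eval x (Poly_Mapping.single v k) = x v ^ k"
  by (simp add: mono_eval_def)

lemma mono_eval_add: "mono_eval x (m + n) = mono_eval x m * mono_eval x n"
proof -
  let ?V = "Poly_Mapping.keys m \<union> Poly_Mapping.keys n"
  have "mono_eval x l = (\<Prod>v\<in>?V. x v ^ Poly_Mapping.lookup l v)" if "l \<in> {m, n, m + n}" for l
    using that Poly_Mapping.keys_add[of m n] by (intro mono_eval_superset) auto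
  then show ?thesis
    by (simp add: lookup_add power_add prod.distrib)
qed

lemma peval_superset:
  assumes "finite S" "Poly_Mapping.keys p \<subseteq> S"
  shows "peval x p = (\<Sum>m\<in>S. of_rat (Poly_Mapping.lookup p m) * mono_eval x m)"
  unfolding peval_def mono_eval_def[symmetric] using assms
  by (intro sum.mono_neutral_left) (auto simp: in_keys_iff)

lemma peval_single: "peval x (Poly_Mapping.single m c) = of_rat c * mono_eval x m"
  by (subst peval_superset[of "{m}"]) auto

lemma peval_pvar [simp]: "peval x (pvar v) = x v"
  by (simp add: pvar_def peval_single)

lemma peval_0 [simp]: "peval x 0 = 0"
  by (simp add: peval_def)

lemma peval_1 [simp]: "peval x 1 = 1"
  using peval_single[of x 0 1] by simp

lemma peval_add: "peval x (p + q) = peval x p + peval x q"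
proof -
  let ?S = "Poly_Mapping.keys p \<union> Poly_Mapping.keys q"
  have "peval x r = (\<Sum>m\<in>?S. of_rat (Poly_Mapping.lookup r m) * mono_eval x m)"
    if "r \<in> {p, q, p + q}" for r
    using that Poly_Mapping.keys_add[of p q] by (intro peval_superset) auto
  then show ?thesis
    by (simp add: lookup_add of_rat_add distrib_right sum.distrib)
qed

lemma peval_sum: "peval x (\<Sum>i\<in>A. p i) = (\<Sum>i\<in>A. peval x (p i))"
  by (induction A rule: infinite_finite_induct) (auto simp: peval_add)

lemma poly_mapping_sum_singles:
  "(\<Sum>m\<in>Poly_Mapping.keys p. Poly_Mapping.single m (Poly_Mapping.lookup p m)) = p"
proof (rule poly_mapping_eqI)
  fix k
  have "(\<Sum>m\<in>Poly_Mapping.keys p. Poly_Mapping.lookup p m when m = k) = Poly_Mapping.lookup p k"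
    by (cases "k \<in> Poly_Mapping.keys p") (auto simp: when_def in_keys_iff)
  then show "Poly_Mapping.lookup (\<Sum>m\<in>Poly_Mapping.keys p.
      Poly_Mapping.single m (Poly_Mapping.lookup p m)) k = Poly_Mapping.lookup p k"
    by (simp add: lookup_sum lookup_single)
qed

lemma peval_mult: "peval x (p * q) = peval x p * peval x q"
proof -
  have "p * q = (\<Sum>m\<in>Poly_Mapping.keys p. \<Sum>n\<in>Poly_Mapping.keys q.
      Poly_Mapping.single (m + n) (Poly_Mapping.lookup p m * Poly_Mapping.lookup q n))"
    by (subst (1 2) poly_mapping_sum_singles[symmetric]) (simp add: sum_product mult_single)
  then have "peval x (p * q) = (\<Sum>m\<in>Poly_Mapping.keys p. \<Sum>n\<in>Poly_Mapping.keys q.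
      (of_rat (Poly_Mapping.lookup p m) * mono_eval x m) *
      (of_rat (Poly_Mapping.lookup q n) * mono_eval x n))"
    by (simp add: peval_sum peval_single mono_eval_add of_rat_mult mult_ac)
  then show ?thesis
    by (simp add: peval_superset[of "Poly_Mapping.keys p" p]
        peval_superset[of "Poly_Mapping.keys q" q] sum_product)
qed

lemma comm_ring_hom_peval: "comm_ring_hom (peval x)"
  by unfold_locales (auto simp: peval_add peval_mult)

section \<open>Formal partial derivatives\<close>

lemma diff_single_add_single:
  fixes m :: "'a \<Rightarrow>\<^sub>0 nat"
  assumes "Poly_Mapping.lookup m v \<noteq> 0"
  shows "m - Poly_Mapping.single v 1 + Poly_Mapping.single v 1 = m"
  using assms by (intro poly_mapping_eqI) (auto simp: lookup_add lookup_minus lookup_single when_def)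

text \<open>The truncated subtraction may send several keys to \<open>m\<close>, but a key not
  involving \<open>v\<close> carries the coefficient 0, so only
  \<open>m + Poly_Mapping.single v 1\<close> contributes. In this form, unlike in the sum over keys,
  additivity in \<open>p\<close> is plain.\<close>

lemma lookup_pdiff:
  "Poly_Mapping.lookup (pdiff v p) m =
     of_nat (Suc (Poly_Mapping.lookup m v)) * Poly_Mapping.lookup p (m + Poly_Mapping.single v 1)"
proof -
  let ?e = "Poly_Mapping.single v (1::nat)"
  have eq: "k - ?e = m \<longleftrightarrow> k = m + ?e" if "Poly_Mapping.lookup k v \<noteq> 0" for k
    using diff_single_add_single[OF that] by auto
  have "Poly_Mapping.lookup (pdiff v p) m = (\<Sum>k\<in>Poly_Mapping.keys p.
      (of_nat (Poly_Mapping.lookup k v) * Poly_Mapping.lookup p k) when k - ?e = m)"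
    by (simp add: pdiff_def lookup_sum lookup_single)
  also have "\<dots> = (\<Sum>k\<in>Poly_Mapping.keys p.
      (of_nat (Poly_Mapping.lookup k v) * Poly_Mapping.lookup p k) when k = m + ?e)"
    by (intro sum.cong refl) (use eq in \<open>auto simp: when_def\<close>)
  also have "\<dots> = of_nat (Suc (Poly_Mapping.lookup m v)) * Poly_Mapping.lookup p (m + ?e)"
    by (cases "m + ?e \<in> Poly_Mapping.keys p")
      (auto simp: when_def in_keys_iff lookup_add)
  finally show ?thesis .
qed

lemma pdiff_add: "pdiff v (p + q) = pdiff v p + pdiff v q"
  by (rule poly_mapping_eqI) (simp add: lookup_pdiff lookup_add distrib_left)

lemma pdiff_0 [simp]: "pdiff v 0 = 0"
  by (simp add: pdiff_def)

lemma pdiff_single: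
  "pdiff v (Poly_Mapping.single m c) =
     Poly_Mapping.single (m - Poly_Mapping.single v 1) (of_nat (Poly_Mapping.lookup m v) * c)"
  by (cases "c = 0") (simp_all add: pdiff_def)

text \<open>This is the Leibniz rule for a monomial times the variable \<open>w\<close>, after
  evaluation. It matches the recursion that builds the quotients below.\<close>

lemma peval_pdiff_single_add:
  "peval x (pdiff v (Poly_Mapping.single (m + Poly_Mapping.single w 1) c)) =
     x w * peval x (pdiff v (Poly_Mapping.single m c)) +
     (if v = w then peval x (Poly_Mapping.single m c) else 0)"
proof (cases "Poly_Mapping.lookup m v = 0")
  case True
  then show ?thesis
    by (simp add: pdiff_single peval_single lookup_add lookup_single when_def)
next
  case False
  \<comment> \<open>Since \<open>v\<close> occurs in \<open>m\<close>, it can be factored out.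
    Subtracting \<open>Poly_Mapping.single v 1\<close> is then a genuine cancellation, also after
    multiplication by \<open>w\<close>.\<close>
  define k where "k = m - Poly_Mapping.single v 1"
  have m: "m = k + Poly_Mapping.single v 1"
    unfolding k_def using diff_single_add_single[OF False] by simp
  have "m + Poly_Mapping.single w 1 - Poly_Mapping.single v 1 = k + Poly_Mapping.single w 1"
    unfolding m add.assoc add.commute[of "Poly_Mapping.single v 1"]
    unfolding add.assoc[symmetric] add_diff_cancel_right' ..
  then have "peval x (pdiff v (Poly_Mapping.single (m + Poly_Mapping.single w 1) c)) =
      (of_nat (Poly_Mapping.lookup m v) + (if v = w then 1 else 0)) * of_rat c *
        (mono_eval x k * x w)"
    by (simp add: pdiff_single peval_single lookup_add lookup_single when_def mono_eval_add
        of_rat_mult of_rat_add)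
  moreover have "peval x (pdiff v (Poly_Mapping.single m c)) =
      of_nat (Poly_Mapping.lookup m v) * of_rat c * mono_eval x k"
    by (simp add: pdiff_single peval_single k_def of_rat_mult)
  moreover have "mono_eval x m = mono_eval x k * x v"
    by (simp add: m mono_eval_add)
  ultimately show ?thesis
    by (simp add: peval_single distrib_left distrib_right)
qed

section \<open>Hadamard quotients of polynomials\<close>

text \<open>Such quotients are in general not unique, so a relation records the properties required
  of them. They are functions of pairs, which makes their continuity joint in both points.\<close>

definition hadamard_quotients ::
    "param set \<Rightarrow> ppoly \<Rightarrow> (param \<Rightarrow> (param \<Rightarrow> real) \<times> (param \<Rightarrow> real) \<Rightarrow> real) \<Rightarrow> bool" where
  "hadamard_quotients V p q \<longleftrightarrow>
     (\<forall>v. continuous_on UNIV (q v) \<and> (\<forall>x. q v (x, x) = peval x (pdiff v p))) \<and>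
     (\<forall>x y. peval x p - peval y p = (\<Sum>v\<in>V. q v (x, y) * (x v - y v)))"

lemma
  assumes "hadamard_quotients V p q"
  shows continuous_on_hadamard_quotient: "continuous_on UNIV (q v)"
    and hadamard_quotient_diagonal: "q v (x, x) = peval x (pdiff v p)"
    and peval_diff_hadamard: "peval x p - peval y p = (\<Sum>v\<in>V. q v (x, y) * (x v - y v))"
  using assms unfolding hadamard_quotients_def by blast+

lemma continuous_on_peval:
  assumes "continuous_on S f"
  shows "continuous_on S (\<lambda>z. peval (f z) p)"
proof -
  have "continuous_on S (\<lambda>z. f z v)" for v
    using assms by (rule continuous_on_product_then_coordinatewise)
  then show ?thesis
    unfolding peval_def by (intro continuous_intros)
qed

text \<open>Induction on the degree, one variable factor being removed at a time. The sum of the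
  exponents over \<open>V\<close> is the whole degree because \<open>V\<close> contains all
  variables of \<open>m\<close>.\<close>

lemma hadamard_quotients_single:
  assumes V: "finite V"
  shows "Poly_Mapping.keys m \<subseteq> V \<Longrightarrow> \<exists>q. hadamard_quotients V (Poly_Mapping.single m c) q"
proof (induction "\<Sum>v\<in>V. Poly_Mapping.lookup m v" arbitrary: m)
  case 0
  then have "m = 0"
    using V by (auto simp: poly_mapping_eq_iff fun_eq_iff subset_iff in_keys_iff)
  then show ?case
    by (auto simp: hadamard_quotients_def pdiff_single peval_single intro!: exI[of _ "\<lambda>_ _. 0"])
next
  case (Suc s)
  then obtain w where w: "w \<in> V" "Poly_Mapping.lookup m w \<noteq> 0"
    by (metis sum.neutral nat.distinct(1))
  define m' where "m' = m - Poly_Mapping.single w 1"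
  have m: "m = m' + Poly_Mapping.single w 1"
    unfolding m'_def using diff_single_add_single[OF w(2)] by simp
  have "(\<Sum>v\<in>V. Poly_Mapping.lookup m v) = Suc (\<Sum>v\<in>V. Poly_Mapping.lookup m' v)"
    using V w(1) by (simp add: m lookup_add sum.distrib lookup_single when_def)
  moreover have "Poly_Mapping.keys m' \<subseteq> V"
    using Suc.prems by (auto simp: m'_def in_keys_iff lookup_minus subset_iff)
  ultimately obtain q where q: "hadamard_quotients V (Poly_Mapping.single m' c) q"
    using Suc.hyps by fastforce
  let ?p = "Poly_Mapping.single m' c"
  \<comment> \<open>The choice is read off from \<open>x w * p x - y w * p y = x w * (p x - p y) + p
    y * (x w - y w)\<close>, where \<open>p\<close> stands for the smaller monomial: the last
    summand is charged to the quotient of \<open>w\<close>.\<close>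
  define q' where "q' v z = fst z w * q v z + (if v = w then peval (snd z) ?p else 0)" for v z
  have "hadamard_quotients V (Poly_Mapping.single m c) q'"
    unfolding hadamard_quotients_def
  proof (intro conjI allI)
    fix v
    show "continuous_on UNIV (q' v)"
    proof -
      have "continuous_on UNIV (\<lambda>z::(param \<Rightarrow> real) \<times> (param \<Rightarrow> real). fst z w)"
        by (rule continuous_on_product_then_coordinatewise) (intro continuous_on_fst continuous_on_id)
      then have "continuous_on UNIV (\<lambda>z. fst z w * q v z)"
        by (intro continuous_on_mult continuous_on_hadamard_quotient[OF q])
      moreover have "continuous_on UNIV (\<lambda>z. peval (snd z) ?p)"
        by (intro continuous_on_peval continuous_on_snd continuous_on_id)
      ultimately show ?thesis
        unfolding q'_def by (cases "v = w") (auto intro: continuous_on_add)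
    qed
    fix x
    show "q' v (x, x) = peval x (pdiff v (Poly_Mapping.single m c))"
      unfolding m peval_pdiff_single_add by (simp add: q'_def hadamard_quotient_diagonal[OF q])
  next
    fix x y
    have ev: "peval z (Poly_Mapping.single m c) = z w * peval z ?p" for z
      by (simp add: m peval_single mono_eval_add)
    have "(\<Sum>v\<in>V. q' v (x, y) * (x v - y v)) =
        x w * (\<Sum>v\<in>V. q v (x, y) * (x v - y v)) +
        (\<Sum>v\<in>V. if v = w then peval y ?p * (x v - y v) else 0)"
      by (auto simp: q'_def sum_distrib_left sum.distrib[symmetric] algebra_simps intro!: sum.cong)
    also have "\<dots> = x w * (peval x ?p - peval y ?p) + peval y ?p * (x w - y w)"
      using V w(1) by (simp add: peval_diff_hadamard[OF q])
    finally show "peval x (Poly_Mapping.single m c) - peval y (Poly_Mapping.single m c) =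
        (\<Sum>v\<in>V. q' v (x, y) * (x v - y v))"
      by (simp add: ev algebra_simps)
  qed
  then show ?case by blast
qed

lemma hadamard_quotients_add:
  assumes "hadamard_quotients V p q" "hadamard_quotients V p' q'"
  shows "hadamard_quotients V (p + p') (\<lambda>v z. q v z + q' v z)"
  unfolding hadamard_quotients_def
proof (intro conjI allI)
  show "continuous_on UNIV (\<lambda>z. q v z + q' v z)" for v
    by (intro continuous_on_add continuous_on_hadamard_quotient[OF assms(1)]
        continuous_on_hadamard_quotient[OF assms(2)])
  show "q v (x, x) + q' v (x, x) = peval x (pdiff v (p + p'))" for v x
    by (simp add: pdiff_add peval_add hadamard_quotient_diagonal[OF assms(1)]
        hadamard_quotient_diagonal[OF assms(2)])
  fix x y
  have "peval x (p + p') - peval y (p + p') =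
      (peval x p - peval y p) + (peval x p' - peval y p')"
    by (simp add: peval_add)
  also have "\<dots> = (\<Sum>v\<in>V. q v (x, y) * (x v - y v)) + (\<Sum>v\<in>V. q' v (x, y) * (x v - y v))"
    by (simp only: peval_diff_hadamard[OF assms(1)] peval_diff_hadamard[OF assms(2)])
  finally show "peval x (p + p') - peval y (p + p') =
      (\<Sum>v\<in>V. (q v (x, y) + q' v (x, y)) * (x v - y v))"
    by (simp add: sum.distrib distrib_right)
qed

lemma hadamard_quotients_exist:
  assumes "finite V" "\<And>m. m \<in> Poly_Mapping.keys p \<Longrightarrow> Poly_Mapping.keys m \<subseteq> V"
  shows "\<exists>q. hadamard_quotients V p q"
proof -
  \<comment> \<open>Generalising to partial sums keeps the coefficients of \<open>p\<close> fixed
    while the induction adds one monomial at a time.\<close>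
  have "\<exists>q. hadamard_quotients V
      (\<Sum>m\<in>A. Poly_Mapping.single m (Poly_Mapping.lookup p m)) q"
    if "A \<subseteq> Poly_Mapping.keys p" for A
    using finite_subset[OF that finite_keys] that
  proof (induction A rule: finite_induct)
    case empty
    then show ?case
      by (auto simp: hadamard_quotients_def intro!: exI[of _ "\<lambda>_ _. 0"])
  next
    case (insert m A)
    then show ?case
      using hadamard_quotients_single[OF assms(1), of m "Poly_Mapping.lookup p m"] assms(2)
      by (auto intro: hadamard_quotients_add)
  qed
  from this[of "Poly_Mapping.keys p"] show ?thesis
    by (simp add: poly_mapping_sum_singles)
qed

section \<open>Zero sets of nonzero polynomials\<close>

text \<open>Induction on the number of variables. For fixed values of the old variables the sum is a
  polynomial in the new one; for almost all such values some coefficient is nonzero, which leaves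
  finitely many roots, and Tonelli's theorem concludes. Injectivity says that the monomials indexed
  by \<open>K\<close> are distinct, so no terms cancel.\<close>

lemma AE_sum_monomials_neq_0:
  fixes c :: "'k \<Rightarrow> real" and e :: "'k \<Rightarrow> 'i \<Rightarrow> nat"
  assumes "finite P" "finite K" "K \<noteq> {}" "inj_on (\<lambda>m. restrict (e m) P) K"
    and "\<And>m. m \<in> K \<Longrightarrow> c m \<noteq> 0"
  shows "AE x in (\<Pi>\<^sub>M v\<in>P. (lborel :: real measure)). (\<Sum>m\<in>K. c m * (\<Prod>v\<in>P. x v ^ e m v)) \<noteq> 0"
  using assms
proof (induction P arbitrary: K rule: finite_induct)
  case empty
  then obtain m where "m \<in> K" by blast
  \<comment> \<open>Without variables all exponent functions restrict to the same function, so the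
    sum is a single nonzero constant.\<close>
  then have "K = {m}"
    using empty.prems(3) by (auto simp: inj_on_def)
  then show ?case
    using empty.prems(4) by simp
next
  case (insert w P)
  interpret product_sigma_finite "\<lambda>_. lborel :: real measure"
    by standard
  obtain m\<^sub>0 where m\<^sub>0: "m\<^sub>0 \<in> K"
    using insert.prems by blast
  define N where "N = Max ((\<lambda>m. e m w) ` K)"
  \<comment> \<open>\<open>g x k\<close> is the coefficient of the \<open>k\<close>-th power of the
    new variable. The exponent of \<open>m\<^sub>0\<close> is one that occurs, so the induction
    hypothesis applies to its coefficient.\<close>
  define g where "g x k = (\<Sum>m | m \<in> K \<and> e m w = k. c m * (\<Prod>v\<in>P. x v ^ e m v))" for x k
  define F where "F x = (\<Sum>m\<in>K. c m * (\<Prod>v\<in>insert w P. x v ^ e m v))" for x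
  have le_N: "e m w \<le> N" if "m \<in> K" for m
    unfolding N_def using insert.prems(1) that by (intro Max_ge) auto
  \<comment> \<open>Monomials with the same exponent at \<open>w\<close> that agree on
    \<open>P\<close> agree on \<open>insert w P\<close>.\<close>
  have inj: "inj_on (\<lambda>m. restrict (e m) P) {m \<in> K. e m w = e m\<^sub>0 w}"
  proof (rule inj_onI)
    fix m m'
    assume m: "m \<in> {m \<in> K. e m w = e m\<^sub>0 w}" "m' \<in> {m \<in> K. e m w = e m\<^sub>0 w}"
      and eq: "restrict (e m) P = restrict (e m') P"
    have "restrict (e m) (insert w P) = restrict (e m') (insert w P)"
    proof (rule restrict_ext)
      fix v
      assume "v \<in> insert w P"
      then show "e m v = e m' v"
        using m fun_cong[OF eq, of v] by (auto split: if_splits)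
    qed
    then show "m = m'"
      by (rule inj_onD[OF insert.prems(3)]) (use m in auto)
  qed
  have g_nz: "AE x in (\<Pi>\<^sub>M v\<in>P. (lborel :: real measure)). g x (e m\<^sub>0 w) \<noteq> 0"
    unfolding g_def using insert.prems m\<^sub>0 by (intro insert.IH inj) auto
  have F_eq: "F (x(w := y)) = (\<Sum>k\<le>N. g x k * y ^ k)" for x y
  proof -
    have "F (x(w := y)) = (\<Sum>m\<in>K. c m * (\<Prod>v\<in>P. x v ^ e m v) * y ^ e m w)"
      unfolding F_def
    proof (intro sum.cong refl)
      fix m
      have "(\<Prod>v\<in>P. (x(w := y)) v ^ e m v) = (\<Prod>v\<in>P. x v ^ e m v)"
        using insert.hyps by (intro prod.cong) auto
      then show "c m * (\<Prod>v\<in>insert w P. (x(w := y)) v ^ e m v) =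
          c m * (\<Prod>v\<in>P. x v ^ e m v) * y ^ e m w"
        using insert.hyps by simp
    qed
    also have "\<dots> = (\<Sum>k\<le>N. \<Sum>m | m \<in> K \<and> e m w = k. c m * (\<Prod>v\<in>P. x v ^ e m v) * y ^ e m w)"
      using insert.prems(1) le_N by (intro sum.group[symmetric]) auto
    also have "\<dots> = (\<Sum>k\<le>N. g x k * y ^ k)"
      unfolding g_def sum_distrib_right by (intro sum.cong) auto
    finally show ?thesis .
  qed
  have F_AE: "AE y in (lborel :: real measure). F (x(w := y)) \<noteq> 0" if "g x (e m\<^sub>0 w) \<noteq> 0" for x
  proof -
    \<comment> \<open>The nonzero coefficient has index \<open>e m\<^sub>0 w\<close>, which is at
      most \<open>N\<close>, so this is not the zero polynomial in \<open>y\<close>.\<close>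
    have "finite {y. (\<Sum>k\<le>N. g x k * y ^ k) = 0}"
      using that le_N[OF m\<^sub>0] unfolding polyfun_finite_roots by blast
    then have "{y. F (x(w := y)) = 0} \<in> null_sets lborel"
      unfolding F_eq by (rule finite_imp_null_set_lborel)
    then show ?thesis
      by (auto dest: AE_not_in)
  qed
  have F_meas [measurable]: "F \<in> borel_measurable (\<Pi>\<^sub>M v\<in>insert w P. (lborel :: real measure))"
    unfolding F_def by measurable
  \<comment> \<open>The integral is the measure of the zero set of \<open>F\<close>; it is computed
    by integrating over the new variable first.\<close>
  have "(\<integral>\<^sup>+ x. indicator {0} (F x) \<partial>(\<Pi>\<^sub>M v\<in>insert w P. (lborel :: real measure))) =
      (\<integral>\<^sup>+ x. (\<integral>\<^sup>+ y. indicator {0} (F (x(w := y))) \<partial>lborel) \<partial>(\<Pi>\<^sub>M v\<in>P. (lborel :: real measure)))"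
    using insert.hyps by (intro product_nn_integral_insert) auto
  also have "\<dots> = (\<integral>\<^sup>+ x. 0 \<partial>(\<Pi>\<^sub>M v\<in>P. (lborel :: real measure)))"
  proof (rule nn_integral_cong_AE, use g_nz in eventually_elim)
    fix x
    assume "g x (e m\<^sub>0 w) \<noteq> 0"
    then have "AE y in (lborel :: real measure). indicator {0} (F (x(w := y))) = (0 :: ennreal)"
      by (rule eventually_mono[OF F_AE]) simp
    then have "(\<integral>\<^sup>+ y. indicator {0} (F (x(w := y))) \<partial>lborel) = (\<integral>\<^sup>+ (y::real). 0 \<partial>lborel)"
      by (rule nn_integral_cong_AE)
    then show "(\<integral>\<^sup>+ y. indicator {0} (F (x(w := y))) \<partial>lborel) = 0"
      by simp
  qed
  also have "\<dots> = 0"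
    by simp
  finally have "AE x in (\<Pi>\<^sub>M v\<in>insert w P. (lborel :: real measure)).
      indicator {0} (F x) = (0 :: ennreal)"
    by (intro iffD1[OF nn_integral_0_iff_AE]) auto
  then show ?case
    unfolding F_def by (auto elim!: eventually_mono simp: indicator_def split: if_splits)
qed

text \<open>Setting the variables outside \<open>P\<close> to 0 kills exactly the monomials that
  involve one of them. The others keep their coefficients and stay distinct on \<open>P\<close>, and
  \<open>m\<^sub>0\<close> is among them.\<close>

lemma AE_peval_restrict_neq_0:
  assumes "finite P" and m\<^sub>0: "m\<^sub>0 \<in> Poly_Mapping.keys p" "Poly_Mapping.keys m\<^sub>0 \<subseteq> P"
  shows "AE x in (\<Pi>\<^sub>M v\<in>P. (lborel :: real measure)). peval (\<lambda>v. if v \<in> P then x v else 0) p \<noteq> 0"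
proof -
  define K where "K = {m \<in> Poly_Mapping.keys p. Poly_Mapping.keys m \<subseteq> P}"
  have "peval (\<lambda>v. if v \<in> P then x v else 0) p =
      (\<Sum>m\<in>K. of_rat (Poly_Mapping.lookup p m) * (\<Prod>v\<in>P. x v ^ Poly_Mapping.lookup m v))" for x
  proof -
    let ?x = "\<lambda>v. if v \<in> P then x v else 0"
    have "mono_eval ?x m = 0" if "m \<in> Poly_Mapping.keys p - K" for m
      using that by (auto simp: K_def mono_eval_def in_keys_iff subset_iff)
    then have "peval ?x p = (\<Sum>m\<in>K. of_rat (Poly_Mapping.lookup p m) * mono_eval ?x m)"
      unfolding peval_superset[OF finite_keys order_refl]
      by (intro sum.mono_neutral_right) (auto simp: K_def)
    also have "\<dots> = (\<Sum>m\<in>K. of_rat (Poly_Mapping.lookup p m) * (\<Prod>v\<in>P. x v ^ Poly_Mapping.lookup m v))"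
      using assms(1) by (intro sum.cong refl) (simp add: K_def mono_eval_superset[of P])
    finally show ?thesis .
  qed
  moreover have "inj_on (\<lambda>m. restrict (Poly_Mapping.lookup m) P) K"
  proof (rule inj_onI, rule poly_mapping_eqI)
    fix m m' v
    assume m: "m \<in> K" "m' \<in> K"
      and eq: "restrict (Poly_Mapping.lookup m) P = restrict (Poly_Mapping.lookup m') P"
    show "Poly_Mapping.lookup m v = Poly_Mapping.lookup m' v"
    proof (cases "v \<in> P")
      case True
      then show ?thesis using fun_cong[OF eq, of v] by simp
    next
      case False
      then have "v \<notin> Poly_Mapping.keys m" "v \<notin> Poly_Mapping.keys m'"
        using m by (auto simp: K_def)
      then show ?thesis by (simp add: in_keys_iff)
    qed
  qed
  ultimately show ?thesis
    using assms by (simp only:) (intro AE_sum_monomials_neq_0, auto simp: K_def in_keys_iff)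
qed

section \<open>Injectivity near a point with nonzero Jacobian determinant\<close>

text \<open>The matrix of Hadamard quotients sends the difference of two points to the difference of
  their values and is nonsingular near the diagonal point. \<open>U\<close> is open in the space of
  all functions, while only the coordinates in \<open>xs\<close> are determined by the
  values.\<close>

lemma local_injectivity:
  assumes xs: "distinct xs" "length xs = n"
    and r: "\<And>i m. i < n \<Longrightarrow> m \<in> Poly_Mapping.keys (r i) \<Longrightarrow> Poly_Mapping.keys m \<subseteq> set xs"
    and det: "Determinant.det (map_mat (peval x) (jacobian xs (Matrix.vec n r))) \<noteq> 0"
  shows "\<exists>U. open U \<and> x \<in> U \<and> (\<forall>y\<in>U. \<forall>z\<in>U.
    (\<forall>i<n. peval y (r i) = peval z (r i)) \<longrightarrow> (\<forall>v\<in>set xs. y v = z v))"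
proof -
  have "\<exists>q. i < n \<longrightarrow> hadamard_quotients (set xs) (r i) q" for i
    using hadamard_quotients_exist[OF finite_set, of "r i" xs] r by blast
  then obtain q where q: "\<And>i. i < n \<Longrightarrow> hadamard_quotients (set xs) (r i) (q i)"
    by metis
  define Q where "Q w = Matrix.mat n n (\<lambda>(i, j). q i (xs ! j) w)" for w
  have Q_carrier: "Q w \<in> carrier_mat n n" for w
    by (simp add: Q_def)
  have Q_diag: "Q (x, x) = map_mat (peval x) (jacobian xs (Matrix.vec n r))"
    using xs(2) by (intro eq_matI) (auto simp: Q_def jacobian_def hadamard_quotient_diagonal[OF q])
  \<comment> \<open>The Leibniz formula expresses the determinant as a polynomial in the entries,
    which are continuous.\<close>
  have "continuous_on UNIV (\<lambda>w. Determinant.det (Q w))"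
    unfolding det_def'[OF Q_carrier]
  proof (intro continuous_on_sum continuous_on_mult continuous_on_const continuous_on_prod)
    fix p i
    assume p: "p \<in> {p. p permutes {0..<n}}" and i: "i \<in> {0..<n}"
    then have "p i < n" by (auto dest: permutes_in_image)
    then show "continuous_on UNIV (\<lambda>w. Q w $$ (i, p i))"
      using i by (simp add: Q_def continuous_on_hadamard_quotient[OF q])
  qed
  then have "open ((\<lambda>w. Determinant.det (Q w)) -` (- {0}))"
    by (intro open_vimage) auto
  moreover have "(x, x) \<in> (\<lambda>w. Determinant.det (Q w)) -` (- {0})"
    using det by (simp add: Q_diag)
  \<comment> \<open>A box around \<open>(x, x)\<close> suffices: both points are then taken from
    \<open>A \<inter> B\<close>.\<close>
  ultimately obtain A B where AB: "open A" "open B" "x \<in> A" "x \<in> B"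
      "A \<times> B \<subseteq> (\<lambda>w. Determinant.det (Q w)) -` (- {0})"
    by (rule open_prod_elim) auto
  show ?thesis
  proof (intro exI[of _ "A \<inter> B"] conjI ballI impI)
    show "open (A \<inter> B)" "x \<in> A \<inter> B"
      using AB by auto
    fix y z v
    assume yz: "y \<in> A \<inter> B" "z \<in> A \<inter> B"
      and eq: "\<forall>i<n. peval y (r i) = peval z (r i)" and v: "v \<in> set xs"
    define d where "d = Matrix.vec n (\<lambda>j. y (xs ! j) - z (xs ! j))"
    have bij: "bij_betw ((!) xs) {0..<n} (set xs)"
      using xs by (metis bij_betw_nth atLeast0LessThan)
    \<comment> \<open>Row \<open>i\<close> of the product is the Hadamard expansion of
      \<open>peval y (r i) - peval z (r i)\<close>, reindexed along \<open>xs\<close>.\<close>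
    have "Q (y, z) *\<^sub>v d = 0\<^sub>v n"
    proof (rule eq_vecI)
      fix i
      assume "i < dim_vec (0\<^sub>v n :: real Matrix.vec)"
      then have i: "i < n" by simp
      have "(\<Sum>j = 0..<n. q i (xs ! j) (y, z) * (y (xs ! j) - z (xs ! j))) =
          (\<Sum>v\<in>set xs. q i v (y, z) * (y v - z v))"
        by (rule sum.reindex_bij_betw[OF bij])
      also have "\<dots> = 0"
        using peval_diff_hadamard[OF q[OF i], of y z] eq i by simp
      finally show "(Q (y, z) *\<^sub>v d) $ i = 0\<^sub>v n $ i"
        using i by (simp add: Q_def d_def scalar_prod_def)
    qed (simp add: Q_def)
    moreover have "Determinant.det (Q (y, z)) \<noteq> 0"
      using AB(5) yz by auto
    moreover have "d \<in> carrier_vec n"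
      by (simp add: d_def)
    ultimately have "d = 0\<^sub>v n"
      using det_0_iff_vec_prod_zero[OF Q_carrier] by blast
    moreover obtain j where "j < n" "v = xs ! j"
      using v xs(2) by (metis in_set_conv_nth)
    ultimately show "y v = z v"
      by (auto simp: d_def dest: arg_cong[of _ _ "\<lambda>d. d $ j"])
  qed
qed

section \<open>The coefficient map under subrings and homomorphisms\<close>

text \<open>A subset of a type, since determinants and characteristic polynomials are formed in the
  type. It serves for the carrier of \<open>param_ring P\<close> and for the polynomials with
  coefficients in a given subring.\<close>

definition unital_subring :: "'a::comm_ring_1 set \<Rightarrow> bool" where
  "unital_subring S \<longleftrightarrow> 1 \<in> S \<and> (\<forall>a\<in>S. \<forall>b\<in>S. a - b \<in> S \<and> a * b \<in> S)"

context
  fixes S :: "'a::comm_ring_1 set"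
  assumes S: "unital_subring S"
begin

lemma unital_subring_one: "1 \<in> S"
  and unital_subring_diff: "a \<in> S \<Longrightarrow> b \<in> S \<Longrightarrow> a - b \<in> S"
  and unital_subring_mult: "a \<in> S \<Longrightarrow> b \<in> S \<Longrightarrow> a * b \<in> S"
  using S by (auto simp: unital_subring_def)

lemma unital_subring_zero: "0 \<in> S"
  using unital_subring_diff[OF unital_subring_one unital_subring_one] by simp

lemma unital_subring_uminus: "a \<in> S \<Longrightarrow> - a \<in> S"
  using unital_subring_diff[OF unital_subring_zero] by simp

lemma unital_subring_add: "a \<in> S \<Longrightarrow> b \<in> S \<Longrightarrow> a + b \<in> S"
  using unital_subring_diff[of a "- b"] unital_subring_uminus by simp

lemma unital_subring_sum: "(\<And>i. i \<in> A \<Longrightarrow> f i \<in> S) \<Longrightarrow> sum f A \<in> S"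
  by (induction A rule: infinite_finite_induct)
    (auto intro: unital_subring_zero unital_subring_add)

lemma unital_subring_prod: "(\<And>i. i \<in> A \<Longrightarrow> f i \<in> S) \<Longrightarrow> prod f A \<in> S"
  by (induction A rule: infinite_finite_induct)
    (auto intro: unital_subring_one unital_subring_mult)

text \<open>The Leibniz formula uses only ring operations; a non-square matrix has determinant 0 by
  convention.\<close>

lemma unital_subring_det:
  assumes "\<And>i j. i < dim_row A \<Longrightarrow> j < dim_col A \<Longrightarrow> A $$ (i, j) \<in> S"
  shows "Determinant.det A \<in> S"
proof (cases "dim_row A = dim_col A")
  case True
  have "(\<Prod>i = 0..<dim_row A. A $$ (i, p i)) \<in> S" if "p permutes {0..<dim_row A}" for p
    using that True by (intro unital_subring_prod assms) (auto dest: permutes_in_image)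
  then have "signof p * (\<Prod>i = 0..<dim_row A. A $$ (i, p i)) \<in> S"
    if "p permutes {0..<dim_row A}" for p
    using that by (auto simp: sign_def intro: unital_subring_uminus)
  then show ?thesis
    unfolding Determinant.det_def using True by (auto intro!: unital_subring_sum)
qed (simp add: Determinant.det_def unital_subring_zero)

lemma unital_subring_coeffs: "unital_subring {p. \<forall>i. Polynomial.coeff p i \<in> S}"
  unfolding unital_subring_def
  by (auto simp: coeff_mult Polynomial.coeff_1 intro: unital_subring_one unital_subring_zero
      unital_subring_diff unital_subring_mult unital_subring_sum)

end

text \<open>The entries of the characteristic matrix are polynomials over \<open>S\<close>, so both
  determinants are too. For \<open>pvar\<close> this says that the coefficients involve model
  parameters only.\<close>

lemma coeff_map_closed:
  fixes a :: "param \<Rightarrow> 'a::comm_ring_1"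
  assumes S: "unital_subring S" and a: "\<And>v. v \<in> params M \<Longrightarrow> a v \<in> S"
    and k: "k < dim_vec (coeff_map M a)"
  shows "coeff_map M a $ k \<in> S"
proof -
  define A where "A = char_poly_matrix (comp_matrix M a)"
  define T where "T = {p. \<forall>i. Polynomial.coeff p i \<in> S}"
  have T: "unital_subring T"
    unfolding T_def by (rule unital_subring_coeffs[OF S])
  have dim: "dim_row A = ncomp M" "dim_col A = ncomp M"
    by (simp_all add: A_def char_poly_matrix_def comp_matrix_def)
  have "comp_entry M a i j \<in> S" for i j
    unfolding comp_entry_def using a
    by (auto simp: params_def intro!: unital_subring_zero[OF S] unital_subring_diff[OF S]
        unital_subring_uminus[OF S] unital_subring_sum[OF S])
  then have A: "A $$ (i, j) \<in> T" if "i < ncomp M" "j < ncomp M" for i j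
    using that by (auto simp: A_def T_def char_poly_matrix_def comp_matrix_def coeff_pCons
        Polynomial.coeff_1 unital_subring_zero[OF S] unital_subring_one[OF S]
        unital_subring_uminus[OF S] split: nat.split)
  have "Determinant.det A \<in> T"
    by (intro unital_subring_det[OF T] A) (simp_all add: dim)
  moreover have "Determinant.det (mat_delete A 0 0) \<in> T"
    by (rule unital_subring_det[OF T]) (simp add: mat_delete_def dim A)
  ultimately show ?thesis
    using k by (auto simp: coeff_map_def Let_def char_poly_def A_def T_def)
qed

lemma dim_coeff_map [simp]: "dim_vec (coeff_map M a) = 2 * ncomp M - 1"
  by (simp add: coeff_map_def Let_def)

text \<open>The construction uses ring operations only. Taking \<open>peval x\<close> as the
  homomorphism identifies the tuple of polynomials, evaluated at \<open>x\<close>, with the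
  coefficient map at \<open>x\<close>.\<close>

lemma (in comm_ring_hom) coeff_map_hom: "coeff_map M (\<lambda>v. hom (a v)) = map_vec hom (coeff_map M a)"
proof -
  interpret map_poly_hom: map_poly_comm_ring_hom hom ..
  have entry: "comp_entry M (\<lambda>v. hom (a v)) i j = hom (comp_entry M a i j)" for i j
    by (simp add: comp_entry_def hom_distribs)
  have A: "comp_matrix M (\<lambda>v. hom (a v)) = map_mat hom (comp_matrix M a)"
    by (intro eq_matI) (auto simp: comp_matrix_def entry)
  have carrier: "comp_matrix M a \<in> carrier_mat (ncomp M) (ncomp M)"
    by (simp add: comp_matrix_def)
  have "mat_delete (map_mat (map_poly hom) B) 0 0 = map_mat (map_poly hom) (mat_delete B 0 0)" for B
    by (intro eq_matI) (auto simp: mat_delete_def)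
  then have "Determinant.det (mat_delete (char_poly_matrix (map_mat hom (comp_matrix M a))) 0 0) =
      map_poly hom (Determinant.det (mat_delete (char_poly_matrix (comp_matrix M a)) 0 0))"
    by (simp add: char_poly_matrix_hom[OF carrier])
  then show ?thesis
    unfolding coeff_map_def Let_def A char_poly_hom[OF carrier] by (intro eq_vecI) auto
qed

lemma peval_coeff_map:
  "k < 2 * ncomp M - 1 \<Longrightarrow> peval x (coeff_map M pvar $ k) = coeff_map M x $ k"
  using comm_ring_hom.coeff_map_hom[OF comm_ring_hom_peval, of M x pvar] by simp

section \<open>Polynomials in the parameters and ideals of variables\<close>

lemma mem_param_ring:
  "p \<in> carrier (param_ring P) \<longleftrightarrow> (\<forall>m\<in>Poly_Mapping.keys p. Poly_Mapping.keys m \<subseteq> P)"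
  by (simp add: param_ring_def)

lemma unital_subring_param_ring: "unital_subring (carrier (param_ring P))"
  unfolding unital_subring_def
proof (intro conjI ballI)
  interpret cring "param_ring P"
    by (rule cring_param_ring)
  show "1 \<in> carrier (param_ring P)"
    by (simp add: mem_param_ring)
  fix p q
  assume pq: "p \<in> carrier (param_ring P)" "q \<in> carrier (param_ring P)"
  show "p * q \<in> carrier (param_ring P)"
    using m_closed[OF pq] by (simp add: param_ring_def)
  show "p - q \<in> carrier (param_ring P)"
    using pq keys_diff[of p q] by (fastforce simp: mem_param_ring)
qed

lemma pvar_param_ring: "v \<in> P \<Longrightarrow> pvar v \<in> carrier (param_ring P)"
  by (simp add: mem_param_ring pvar_def)

lemma pdiff_param_ring:
  assumes "p \<in> carrier (param_ring P)"
  shows "pdiff v p \<in> carrier (param_ring P)"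
  unfolding mem_param_ring
proof
  fix m
  assume "m \<in> Poly_Mapping.keys (pdiff v p)"
  then have "m + Poly_Mapping.single v 1 \<in> Poly_Mapping.keys p"
    by (auto simp: in_keys_iff lookup_pdiff)
  then have "Poly_Mapping.keys (m + Poly_Mapping.single v 1) \<subseteq> P"
    using assms unfolding mem_param_ring by blast
  then show "Poly_Mapping.keys m \<subseteq> P"
    by (auto simp: in_keys_iff lookup_add subset_iff)
qed

lemma coeff_map_param_ring:
  "k < 2 * ncomp M - 1 \<Longrightarrow> coeff_map M pvar $ k \<in> carrier (param_ring (params M))"
  by (intro coeff_map_closed unital_subring_param_ring pvar_param_ring) auto

lemma det_jacobian_param_ring:
  assumes "\<And>i. i < dim_vec c \<Longrightarrow> c $ i \<in> carrier (param_ring P)"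
  shows "Determinant.det (jacobian xs c) \<in> carrier (param_ring P)"
  using assms by (intro unital_subring_det unital_subring_param_ring)
    (auto simp: jacobian_def intro: pdiff_param_ring)

text \<open>Every monomial of \<open>p\<close> is divisible by a variable from \<open>J\<close>, and
  \<open>p\<close> is the sum of its monomial terms. In contrapositive form, a polynomial outside
  the ideal has a monomial free of \<open>J\<close>.\<close>

lemma param_ring_ideal_pvars:
  assumes p: "p \<in> carrier (param_ring P)" and J: "J \<subseteq> P"
    and meets: "\<And>m. m \<in> Poly_Mapping.keys p \<Longrightarrow> Poly_Mapping.keys m \<inter> J \<noteq> {}"
  shows "p \<in> Idl\<^bsub>param_ring P\<^esub> (pvar ` J)"
proof -
  let ?R = "param_ring P"
  let ?Idl = "Idl\<^bsub>?R\<^esub> (pvar ` J)"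
  interpret cring ?R
    by (rule cring_param_ring)
  have sub: "pvar ` J \<subseteq> carrier ?R"
    using J pvar_param_ring by blast
  interpret Idl: ideal ?Idl ?R
    by (rule genideal_ideal[OF sub])
  have mult: "a * b \<in> ?Idl" if "a \<in> carrier ?R" "b \<in> ?Idl" for a b
    using Idl.I_l_closed[OF that(2,1)] by (simp add: param_ring_def)
  have add: "a + b \<in> ?Idl" if "a \<in> ?Idl" "b \<in> ?Idl" for a b
    using Idl.a_closed[OF that] by (simp add: param_ring_def)
  have zero: "0 \<in> ?Idl"
    using Idl.zero_closed by (simp add: param_ring_def)
  have single: "Poly_Mapping.single m c \<in> ?Idl"
    if m: "Poly_Mapping.keys m \<subseteq> P" "Poly_Mapping.keys m \<inter> J \<noteq> {}" for m c
  proof -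
    obtain v where v: "v \<in> J" "Poly_Mapping.lookup m v \<noteq> 0"
      using m(2) by (auto simp: in_keys_iff)
    define k where "k = m - Poly_Mapping.single v 1"
    have "m = k + Poly_Mapping.single v 1"
      unfolding k_def using diff_single_add_single[OF v(2)] by simp
    then have "Poly_Mapping.single m c = Poly_Mapping.single k c * pvar v"
      by (simp add: pvar_def mult_single)
    moreover have "Poly_Mapping.keys k \<subseteq> P"
      using m(1) by (auto simp: k_def in_keys_iff lookup_minus subset_iff)
    then have "Poly_Mapping.single k c \<in> carrier ?R"
      by (simp add: mem_param_ring)
    moreover have "pvar v \<in> ?Idl"
      using v(1) genideal_self[OF sub] by blast
    ultimately show ?thesis
      using mult by simp
  qed
  have "(\<Sum>m\<in>A. Poly_Mapping.single m (Poly_Mapping.lookup p m)) \<in> ?Idl"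
    if "A \<subseteq> Poly_Mapping.keys p" for A
    using finite_subset[OF that finite_keys] that
  proof (induction A rule: finite_induct)
    case (insert m A)
    then show ?case
      using p meets single by (simp add: add mem_param_ring)
  qed (simp add: zero)
  from this[of "Poly_Mapping.keys p"] show ?thesis
    by (simp add: poly_mapping_sum_singles)
qed

section \<open>The singular locus and the deletion of edges\<close>

text \<open>Both cases of the definition take one form: with as many parameters as coefficients, the
  identity list selects all of them.\<close>

lemma singular_locus_eqE:
  assumes "singular_locus_eq M f"
  obtains xs rs where "distinct xs" "set xs = params M" "length rs = length xs"
    "set rs \<subseteq> {..<2 * ncomp M - 1}"
    "f = Determinant.det (jacobian xs (Matrix.vec (length xs) (\<lambda>i. coeff_map M pvar $ (rs ! i)))) \<or>
     f = - Determinant.det (jacobian xs (Matrix.vec (length xs) (\<lambda>i. coeff_map M pvar $ (rs ! i))))"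
proof -
  from assms obtain xs where xs: "distinct xs" "set xs = params M" and
    f: "length xs = 2 * ncomp M - 1 \<and> f \<in> {Determinant.det (jacobian xs (coeff_map M pvar)),
        - Determinant.det (jacobian xs (coeff_map M pvar))} \<or>
      (\<exists>rs. set rs \<subseteq> {..<2 * ncomp M - 1} \<and> length rs = length xs \<and>
        f \<in> {Determinant.det (jacobian xs (Matrix.vec (length xs) (\<lambda>i. coeff_map M pvar $ (rs ! i)))),
          - Determinant.det (jacobian xs (Matrix.vec (length xs) (\<lambda>i. coeff_map M pvar $ (rs ! i))))})"
    unfolding singular_locus_eq_def Let_def dim_coeff_map by blast
  from f show ?thesis
  proof
    assume *: "length xs = 2 * ncomp M - 1 \<and> f \<in> {Determinant.det (jacobian xs (coeff_map M pvar)),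
        - Determinant.det (jacobian xs (coeff_map M pvar))}"
    then have "Matrix.vec (length xs) (\<lambda>i. coeff_map M pvar $ ([0..<length xs] ! i)) =
        coeff_map M pvar"
      by (intro eq_vecI) auto
    then show ?thesis
      using * by (intro that[OF xs, of "[0..<length xs]"]) auto
  qed (use that[OF xs] in blast)
qed

text \<open>Deleting an edge changes the compartmental matrix just as setting its parameter to 0
  does, both in the off-diagonal entry and in the diagonal sum.\<close>

lemma coeff_map_delete_edges:
  assumes M: "linear_compartmental_model M" and I: "I \<subseteq> parcs (graph M)"
  shows "coeff_map (delete_edges M I) x =
    coeff_map M (\<lambda>v. if v \<in> params (delete_edges M I) then x v else 0)"
    (is "_ = coeff_map M ?x")
proof -
  interpret pair_digraph "graph M"
    using M by (simp add: linear_compartmental_model_def)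
  \<comment> \<open>Compartments are numbered from 1, so no edge parameter has the form
    \<open>(0, i)\<close>: leak parameters survive the deletion and cannot be confused with those of
    deleted edges.\<close>
  have pos: "j \<noteq> 0" if "(i, j) \<in> parcs (graph M)" for i j
    using that in_arcsD2 M by (fastforce simp: linear_compartmental_model_def)
  have leak: "(0, i) \<in> params (delete_edges M I) \<longleftrightarrow> i \<in> leaks M" for i
    using pos by (auto simp: params_def delete_edges_def)
  have edge: "(j, i) \<in> params (delete_edges M I) \<longleftrightarrow> (i, j) \<notin> I" if "(i, j) \<in> parcs (graph M)" for i j
    using that pos by (auto simp: params_def delete_edges_def)
  have "finite {k. (i, k) \<in> parcs (graph M)}" for i
    by (rule finite_subset[of _ "snd ` parcs (graph M)"]) (force, simp)
  then have "(\<Sum>k | (i, k) \<in> parcs (graph M) - I. x (k, i)) =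
      (\<Sum>k | (i, k) \<in> parcs (graph M). ?x (k, i))" for i
    by (intro sum.mono_neutral_cong_left) (auto simp: edge)
  then have entry: "comp_entry (delete_edges M I) x i j = comp_entry M ?x i j" for i j
    using edge leak I by (auto simp: comp_entry_def delete_edges_def)
  have n: "ncomp (delete_edges M I) = ncomp M"
    by (simp add: ncomp_def delete_edges_def)
  have "comp_matrix (delete_edges M I) x = comp_matrix M ?x"
    unfolding comp_matrix_def n entry ..
  then show ?thesis
    unfolding coeff_map_def n by simp
qed

section \<open>Local identifiability of the submodel\<close>

theorem theorem3p1:
  fixes M :: comp_model and f :: ppoly and I :: "(nat \<times> nat) set"
  assumes "linear_compartmental_model M"
    and "inputs M = {1}" and "outputs M = {1}"
    and "strongly_connected (with_proj (graph M))"
    and "gen_loc_identifiable M"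
    and "singular_locus_eq M f"
    and "I \<subseteq> parcs (graph M)"
    and "strongly_connected (with_proj (graph (delete_edges M I)))"
    and "f \<notin> Idl\<^bsub>param_ring (params M)\<^esub> {pvar (j, i) | i j. (i, j) \<in> I}"
  shows "gen_loc_identifiable (delete_edges M I)"
proof -
  define P where "P = params (delete_edges M I)"
  define ext :: "(param \<Rightarrow> real) \<Rightarrow> param \<Rightarrow> real"
    where "ext x v = (if v \<in> P then x v else 0)" for x v
  obtain xs rs where xs: "distinct xs" "set xs = params M" and
    rs: "length rs = length xs" "set rs \<subseteq> {..<2 * ncomp M - 1}" and
    f: "f = Determinant.det (jacobian xs (Matrix.vec (length xs) (\<lambda>i. coeff_map M pvar $ (rs ! i)))) \<or>
     f = - Determinant.det (jacobian xs (Matrix.vec (length xs) (\<lambda>i. coeff_map M pvar $ (rs ! i))))"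
    by (rule singular_locus_eqE[OF assms(6)])
  define r where "r i = coeff_map M pvar $ (rs ! i)" for i
  define D where "D = Determinant.det (jacobian xs (Matrix.vec (length xs) r))"
  have rs_less: "rs ! i < 2 * ncomp M - 1" if "i < length xs" for i
    using rs that by (metis lessThan_iff nth_mem subsetD)
  have r: "r i \<in> carrier (param_ring (params M))" if "i < length xs" for i
    unfolding r_def by (intro coeff_map_param_ring rs_less that)
  have f_D: "f = D \<or> f = - D"
    using f by (simp add: D_def r_def[abs_def])
  have "D \<in> carrier (param_ring (params M))"
    unfolding D_def by (rule det_jacobian_param_ring) (simp add: r)
  then have f_carrier: "f \<in> carrier (param_ring (params M))"
    using f_D unital_subring_uminus[OF unital_subring_param_ring] by blast
  \<comment> \<open>The parameter names of the deleted edges, with the two indices swapped.\<close>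
  define J where "J = {(j, i) | i j. (i, j) \<in> I}"
  have J: "J \<subseteq> params M"
    using assms(7) by (auto simp: J_def params_def)
  have "{pvar (j, i) | i j. (i, j) \<in> I} = pvar ` J"
    by (auto simp: J_def)
  then obtain m where m: "m \<in> Poly_Mapping.keys f" "Poly_Mapping.keys m \<inter> J = {}"
    using param_ring_ideal_pvars[OF f_carrier J] assms(9) by auto
  have "params M \<subseteq> P \<union> J"
    by (auto simp: P_def J_def params_def delete_edges_def)
  then have m_P: "Poly_Mapping.keys m \<subseteq> P"
    using f_carrier m by (auto simp: mem_param_ring)
  have P_sub: "P \<subseteq> params M"
    by (auto simp: P_def params_def delete_edges_def)
  then have "finite P"
    using xs(2) by (metis finite_set finite_subset)
  then have "AE x in (\<Pi>\<^sub>M v\<in>P. (lborel :: real measure)). peval (ext x) f \<noteq> 0"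
    unfolding ext_def[abs_def] using m(1) m_P by (rule AE_peval_restrict_neq_0)
  then have "AE x in (\<Pi>\<^sub>M v\<in>P. (lborel :: real measure)).
      \<exists>U. openin (product_topology (\<lambda>_. euclideanreal) P) U \<and> x \<in> U \<and>
        inj_on (coeff_map (delete_edges M I)) U"
  proof (rule AE_mp, intro AE_I2 impI)
    fix x
    assume "x \<in> space (\<Pi>\<^sub>M v\<in>P. (lborel :: real measure))" and nz: "peval (ext x) f \<noteq> 0"
    then have x: "x \<in> P \<rightarrow>\<^sub>E UNIV"
      by (simp add: space_PiM)
    interpret ev: comm_ring_hom "peval (ext x)"
      by (rule comm_ring_hom_peval)
    have "peval (ext x) D \<noteq> 0"
      using nz f_D by (auto simp: ev.hom_uminus)
    then have det: "Determinant.det (map_mat (peval (ext x)) (jacobian xs (Matrix.vec (length xs) r))) \<noteq> 0"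
      by (simp add: D_def)
    have keys: "Poly_Mapping.keys l \<subseteq> set xs"
      if "i < length xs" "l \<in> Poly_Mapping.keys (r i)" for i l
      using r[OF that(1)] that(2) xs(2) by (simp add: mem_param_ring)
    have "\<exists>U. open U \<and> ext x \<in> U \<and> (\<forall>y\<in>U. \<forall>z\<in>U.
        (\<forall>i<length xs. peval y (r i) = peval z (r i)) \<longrightarrow> (\<forall>v\<in>set xs. y v = z v))"
      using det keys by (intro local_injectivity xs(1) refl)
    then obtain U where U: "open U" "ext x \<in> U" and
      inj: "\<forall>y\<in>U. \<forall>z\<in>U. (\<forall>i<length xs. peval y (r i) = peval z (r i)) \<longrightarrow>
        (\<forall>v\<in>set xs. y v = z v)"
      by blast
    \<comment> \<open>The neighbourhood of \<open>x\<close> is the preimage under \<open>ext\<close>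
      of the neighbourhood of \<open>ext x\<close> in the full parameter space.\<close>
    define W where "W = {y \<in> P \<rightarrow>\<^sub>E UNIV. ext y \<in> U}"
    \<comment> \<open>Each coordinate of \<open>ext\<close> is a projection or constantly 0.\<close>
    have "continuous_map (product_topology (\<lambda>_. euclideanreal) P) euclidean ext"
      unfolding euclidean_product_topology[symmetric] continuous_map_componentwise_UNIV
    proof
      fix v
      show "continuous_map (product_topology (\<lambda>_. euclideanreal) P) euclideanreal (\<lambda>x. ext x v)"
        using continuous_map_product_projection[of v P "\<lambda>_. euclideanreal"]
        by (cases "v \<in> P") (simp_all add: ext_def)
    qed
    from openin_continuous_map_preimage[OF this, of U] U(1)
    have "openin (product_topology (\<lambda>_. euclideanreal) P) W"
      by (simp add: W_def topspace_product_topology)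
    moreover have "x \<in> W"
      using x U by (simp add: W_def)
    moreover have "inj_on (coeff_map (delete_edges M I)) W"
    proof (rule inj_onI)
      fix y z
      assume yz: "y \<in> W" "z \<in> W"
        and eq: "coeff_map (delete_edges M I) y = coeff_map (delete_edges M I) z"
      have "coeff_map M (ext y) = coeff_map M (ext z)"
        using eq unfolding coeff_map_delete_edges[OF assms(1,7)] P_def[symmetric] ext_def[abs_def] .
      then have "peval (ext y) (r i) = peval (ext z) (r i)" if "i < length xs" for i
        using rs_less[OF that] by (simp add: r_def peval_coeff_map)
      then have ext_eq: "ext y v = ext z v" if "v \<in> P" for v
        using inj yz that P_sub xs(2) unfolding W_def by blast
      \<comment> \<open>Points of the parameter space are \<open>undefined\<close> outside
        \<open>P\<close>, so agreement on \<open>P\<close> is equality.\<close>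
      show "y = z"
      proof (rule PiE_ext)
        show "y \<in> P \<rightarrow>\<^sub>E UNIV" "z \<in> P \<rightarrow>\<^sub>E UNIV"
          using yz by (auto simp: W_def)
        show "y v = z v" if "v \<in> P" for v
          using ext_eq[OF that] that by (simp add: ext_def)
      qed
    qed
    ultimately show "\<exists>U. openin (product_topology (\<lambda>_. euclideanreal) P) U \<and> x \<in> U \<and>
        inj_on (coeff_map (delete_edges M I)) U"
      by blast
  qed
  then show ?thesis
    unfolding gen_loc_identifiable_def P_def .
qed

end
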